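(* Let $d\ge1$, let $M$ be a $d\times d$ integer matrix with all eigenvalues of modulus $>1$, and let $P$ be a $d\times d$ integer matrix with $p:=|\det P|\neq0$ that is an admissible oversampling matrix for $M$. For $f,g\in L^2(\mathbb{R}^d)$, $k\in\mathbb{Z}^d$, $j\in\mathbb{Z}$ and $r\in\{0,\dots,p-1\}$, $$\langle\mathbf{D}'^j\mathbf{T}'_kS'f,\ \mathbf{T}'_{P\theta_r}S'g\rangle_H=\delta_{l,\sigma^j(r)}\,\langle D^jT_{P^{-1}k}f,\ T_{\theta_r}g\rangle_{L^2(\mathbb{R}^d)},$$ where $l\in\{0,\dots,p-1\}$ is the unique index such that $k=P\theta_l+Pm$ for some $m\in\mathbb{Z}^d$.
   Context: $P$ is admissible for $M$ if $M':=PMP^{-1}$ has integer entries and $M^{-1}\mathbb{Z}^d\cap P^{-1}\mathbb{Z}^d=\mathbb{Z}^d$. For $f\in L^2(\mathbb{R}^d)$: $Df(x)=\sqrt{|\det M|}f(Mx)$, $D'f(x)=\sqrt{|\det M'|}f(M'x)$, $T_uf(x)=f(x-u)$. Let $\{\theta_r:0\le r\le p-1\}$ be a complete set of representatives of $P^{-1}\mathbb{Z}^d/\mathbb{Z}^d$ with $\theta_0=0$, and $\{\theta^*_q:0\le q\le p-1\}$ a complete set of representatives of $(P^* )^{-1}\mathbb{Z}^d/\mathbb{Z}^d$ with $\theta^*_0=0$ ($P^*$ the transpose). $\sigma$ is the permutation of $\{0,\dots,p-1\}$ with $M\theta_r\equiv\theta_{\sigma(r)}\bmod\mathbb{Z}^d$,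 and $\sigma^*$ the permutation with $M'^*\theta^*_q\equiv\theta^*_{\sigma^*(q)}\bmod\mathbb{Z}^d$ (these are permutations by admissibility). $H=L^2(\mathbb{R}^d)^{\oplus p}$ with elements $(f_q)_{0\le q\le p-1}$. Unitaries on $H$: $\mathbf{T}'_k(f_q)_q=(e^{2\pi ik\cdot\theta^*_q}T_kf_q)_q$ ($k\in\mathbb{Z}^d$), $\mathbf{D}'(f_q)_q=(D'f_{(\sigma^* )^{-1}(q)})_q$. $S'f=\frac1p\big(f(P^{-1}\cdot),\dots,f(P^{-1}\cdot)\big)$. *)

theory Defs
  imports "HOL-Analysis.Analysis"
begin

section \<open>Lattice, matrices\<close>

definition Zd :: "(real^'d) set" where
  "Zd = {v. \<forall>i. v $ i \<in> \<int>}"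

definition rmat :: "int^'d^'d \<Rightarrow> real^'d^'d" where
  "rmat A = (\<chi> i j. real_of_int (A $ i $ j))"

definition int_entries :: "real^'d^'d \<Rightarrow> bool" where
  "int_entries A \<longleftrightarrow> (\<forall>i j. A $ i $ j \<in> \<int>)"

text \<open>All (complex) eigenvalues of M have modulus > 1.\<close>
definition expansive :: "int^'d^'d \<Rightarrow> bool" where
  "expansive M \<longleftrightarrow> (\<forall>(c::complex) (v::complex^'d).
      v \<noteq> 0 \<and> (\<chi> i j. of_int (M $ i $ j)) *v v = c *s v \<longrightarrow> cmod c > 1)"

text \<open>P is admissible for M: M' = P M P^{-1} integral and M^{-1}Z^d \<inter> P^{-1}Z^d = Z^d.\<close>
definition admissible :: "int^'d^'d \<Rightarrow> int^'d^'d \<Rightarrow> bool" where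
  "admissible P M \<longleftrightarrow>
     int_entries (rmat P ** rmat M ** matrix_inv (rmat P)) \<and>
     {x. rmat M *v x \<in> Zd} \<inter> {x. rmat P *v x \<in> Zd} = Zd"

text \<open>th is a complete set of representatives (indices 0..<p) of A^{-1}Z^d / Z^d, with th 0 = 0.\<close>
definition reps :: "real^'d^'d \<Rightarrow> nat \<Rightarrow> (nat \<Rightarrow> real^'d) \<Rightarrow> bool" where
  "reps A p th \<longleftrightarrow>
     th 0 = 0 \<and>
     (\<forall>r<p. A *v th r \<in> Zd) \<and>
     (\<forall>r<p. \<forall>s<p. th r - th s \<in> Zd \<longrightarrow> r = s) \<and>
     (\<forall>x. A *v x \<in> Zd \<longrightarrow> (\<exists>r<p. x - th r \<in> Zd))"

text \<open>Integer powers of a permutation.\<close>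
definition perm_ipow :: "(nat \<Rightarrow> nat) \<Rightarrow> int \<Rightarrow> nat \<Rightarrow> nat" where
  "perm_ipow s j = (if 0 \<le> j then s ^^ nat j else (inv s) ^^ nat (- j))"

section \<open>Operators on L^2(R^d)\<close>

definition L2 :: "(real^'d \<Rightarrow> complex) \<Rightarrow> bool" where
  "L2 f \<longleftrightarrow> f \<in> borel_measurable lborel \<and> integrable lborel (\<lambda>x. (cmod (f x))\<^sup>2)"

definition ip :: "(real^'d \<Rightarrow> complex) \<Rightarrow> (real^'d \<Rightarrow> complex) \<Rightarrow> complex" where
  "ip f g = integral\<^sup>L lborel (\<lambda>x. f x * cnj (g x))"

definition transl :: "real^'d \<Rightarrow> (real^'d \<Rightarrow> complex) \<Rightarrow> real^'d \<Rightarrow> complex" where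
  "transl u f x = f (x - u)"

definition dil :: "real^'d^'d \<Rightarrow> (real^'d \<Rightarrow> complex) \<Rightarrow> real^'d \<Rightarrow> complex" where
  "dil A f x = complex_of_real (sqrt \<bar>det A\<bar>) * f (A *v x)"

text \<open>D^j for integer j; D^{-1} is dilation by A^{-1}.\<close>
definition dil_pow :: "real^'d^'d \<Rightarrow> int \<Rightarrow> (real^'d \<Rightarrow> complex) \<Rightarrow> real^'d \<Rightarrow> complex" where
  "dil_pow A j = (if 0 \<le> j then dil A ^^ nat j else dil (matrix_inv A) ^^ nat (- j))"

section \<open>Operators on H = L^2(R^d)^p, elements indexed by q < p\<close>

type_synonym ('d) vecfun = "nat \<Rightarrow> real^'d \<Rightarrow> complex"

definition ipH :: "nat \<Rightarrow> ('d::finite) vecfun \<Rightarrow> ('d::finite) vecfun \<Rightarrow> complex" where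
  "ipH p F G = (\<Sum>q<p. ip (F q) (G q))"

text \<open>T'_k (f_q)_q = (e^{2 pi i k.th*_q} T_k f_q)_q\<close>
definition TH :: "(nat \<Rightarrow> real^'d) \<Rightarrow> real^'d \<Rightarrow> ('d::finite) vecfun \<Rightarrow> ('d::finite) vecfun" where
  "TH ths k F = (\<lambda>q x. exp (2 * of_real pi * \<i> * of_real (k \<bullet> ths q)) * transl k (F q) x)"

text \<open>D' (f_q)_q = (D' f_{sigma*^{-1}(q)})_q\<close>
definition DH :: "real^'d^'d \<Rightarrow> (nat \<Rightarrow> nat) \<Rightarrow> ('d::finite) vecfun \<Rightarrow> ('d::finite) vecfun" where
  "DH A s F = (\<lambda>q. dil A (F (inv s q)))"

text \<open>Inverse of D': (f_q)_q \<mapsto> (D'^{-1} f_{sigma*(q)})_q\<close>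
definition DH_inv :: "real^'d^'d \<Rightarrow> (nat \<Rightarrow> nat) \<Rightarrow> ('d::finite) vecfun \<Rightarrow> ('d::finite) vecfun" where
  "DH_inv A s F = (\<lambda>q. dil (matrix_inv A) (F (s q)))"

definition DH_pow :: "real^'d^'d \<Rightarrow> (nat \<Rightarrow> nat) \<Rightarrow> int \<Rightarrow> ('d::finite) vecfun \<Rightarrow> ('d::finite) vecfun" where
  "DH_pow A s j = (if 0 \<le> j then DH A s ^^ nat j else DH_inv A s ^^ nat (- j))"

text \<open>S' f = (1/p)(f(P^{-1}.), ..., f(P^{-1}.)) (components q < p; zero beyond)\<close>
definition S' :: "nat \<Rightarrow> real^'d^'d \<Rightarrow> (real^'d \<Rightarrow> complex) \<Rightarrow> ('d::finite) vecfun" where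
  "S' p A f = (\<lambda>q x. if q < p then f (matrix_inv A *v x) / of_nat p else 0)"

end

theory Submission
  imports Defs
begin

text \<open>
  In every component q of the left-hand side, the substitution x = P y turns the integrand into
  a phase factor times the integrand of the inner product of D^j T_{P^{-1}k} f and
  T_{theta_r} g; the Jacobian |det P| = p cancels one of the two factors 1/p of S'.
  Writing e(t) = exp(2 pi i t), the phase of component q is
  e(k . theta*_{pi q} - P theta_r . theta*_q) with pi = sigma*^{-j}.
  Since the permutations sigma and sigma* are adjoint for the pairing
  (a, b) -> P theta_a . theta*_b modulo 1, it equals the character
  y -> e((theta_l - theta_{sigma^j r}) . P^T y) at theta*_{pi q}. Summed over the
  representatives theta*_q this character gives p or 0, according as
  theta_l - theta_{sigma^j r} is integral, i.e. l = sigma^j r.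
\<close>

lemma
  fixes A :: "'a::field^'n^'n"
  assumes "invertible A"
  shows matrix_mul_matrix_inv: "A ** matrix_inv A = mat 1"
    and matrix_inv_mul_matrix: "matrix_inv A ** A = mat 1"
  using someI_ex[OF assms[unfolded invertible_def]] by (simp_all add: matrix_inv_def)

lemma matrix_inv_unique:
  fixes A B :: "'a::field^'n^'n"
  assumes "A ** B = mat 1"
  shows "matrix_inv A = B"
proof -
  have "invertible A"
    using assms matrix_left_right_inverse invertible_def by blast
  have "matrix_inv A = matrix_inv A ** (A ** B)"
    by (simp add: assms)
  also have "\<dots> = (matrix_inv A ** A) ** B"
    by (simp add: matrix_mul_assoc)
  also have "\<dots> = B"
    by (simp add: matrix_inv_mul_matrix[OF \<open>invertible A\<close>])
  finally show ?thesis .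
qed

lemma
  fixes A :: "'a::field^'n^'n"
  assumes "invertible A"
  shows matrix_vector_mul_matrix_inv: "A *v (matrix_inv A *v x) = x"
    and matrix_inv_matrix_vector_mul: "matrix_inv A *v (A *v x) = x"
  by (simp_all add: matrix_vector_mul_assoc matrix_mul_matrix_inv[OF assms]
      matrix_inv_mul_matrix[OF assms])

lemma invertible_matrix_inv: "invertible A \<Longrightarrow> invertible (matrix_inv (A::'a::field^'n^'n))"
  using matrix_inv_mul_matrix invertible_right_inverse by blast

lemma det_mul_det_matrix_inv:
  fixes A :: "'a::field^'n^'n"
  assumes "invertible A"
  shows "det A * det (matrix_inv A) = 1"
  using det_mul[of A "matrix_inv A"] by (simp add: matrix_mul_matrix_inv[OF assms])

lemma matrix_inv_conjugate:
  fixes P A :: "'a::field^'n^'n"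
  assumes "invertible P" "invertible A"
  shows "matrix_inv (P ** A ** matrix_inv P) = P ** matrix_inv A ** matrix_inv P"
proof (rule matrix_inv_unique)
  have "P ** A ** matrix_inv P ** (P ** matrix_inv A ** matrix_inv P)
      = P ** (A ** (matrix_inv P ** P) ** matrix_inv A) ** matrix_inv P"
    by (simp add: matrix_mul_assoc)
  then show "P ** A ** matrix_inv P ** (P ** matrix_inv A ** matrix_inv P) = mat 1"
    by (simp add: assms matrix_mul_matrix_inv matrix_inv_mul_matrix)
qed

lemma det_conjugate:
  fixes P A :: "'a::field^'n^'n"
  assumes "invertible P"
  shows "det (P ** A ** matrix_inv P) = det A"
  using det_mul_det_matrix_inv[OF assms] by (simp add: det_mul algebra_simps)

lemma abs_det_matrix_involution:
  fixes g :: "real^'n::finite \<Rightarrow> real^'n"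
  assumes lin: "linear g" and "g \<circ> g = id"
  shows "\<bar>det (matrix g)\<bar> = 1"
proof -
  have "matrix g ** matrix g = matrix (g \<circ> g)"
    using matrix_compose[OF lin lin] by simp
  also have "\<dots> = mat 1"
    using assms(2) matrix_id_mat_1 by simp
  finally have "det (matrix g) * det (matrix g) = 1"
    by (simp only: det_mul[symmetric] det_I)
  then show ?thesis
    using power2_eq_1_iff[of "det (matrix g)"] by (auto simp: power2_eq_square)
qed

lemma measure_swap_coordinates_cbox:
  fixes a b :: "real^'n::finite"
  shows "measure lebesgue ((\<lambda>x. \<chi> i. x $ Transposition.transpose m n i) ` cbox a b)
           = measure lebesgue (cbox a b)"
proof (cases "cbox a b = {}")
  case False
  let ?g = "\<lambda>x::real^'n. \<chi> i. x $ Transposition.transpose m n i"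
  have image: "?g ` cbox a b = cbox (?g a) (?g b)"
  proof
    show "cbox (?g a) (?g b) \<subseteq> ?g ` cbox a b"
    proof
      fix x assume "x \<in> cbox (?g a) (?g b)"
      then have "?g x \<in> cbox a b"
        by (simp add: mem_box_cart) (metis transpose_involutory)
      moreover have "x = ?g (?g x)"
        by (simp add: vec_eq_iff)
      ultimately show "x \<in> ?g ` cbox a b" by blast
    qed
  qed (auto simp: mem_box_cart)
  have "cbox (?g a) (?g b) \<noteq> {}"
    using False image by auto
  then have "measure lborel (cbox (?g a) (?g b)) = measure lborel (cbox a b)"
    using False prod.permute[OF permutes_swap_id, where S=UNIV and g="\<lambda>i. b $ i - a $ i"]
    by (simp add: content_cbox_cart o_def)
  then show ?thesis
    by (simp add: image)
qed simp

lemma det_matrix_shear: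
  fixes m n :: "'n::finite"
  assumes "m \<noteq> n"
  shows "det (matrix (\<lambda>x::real^'n. \<chi> i. if i = m then x $ m + x $ n else x $ i)) = 1"
proof -
  have "matrix (\<lambda>x::real^'n. \<chi> i. if i = m then x $ m + x $ n else x $ i)
      = (\<chi> k. if k = m then row m (mat 1) + 1 *s row n (mat 1) else row k (mat 1))"
    using assms by (auto simp: matrix_def vec_eq_iff row_def mat_def axis_def)
  then show ?thesis
    using det_row_operation[OF assms, of "mat 1 :: real^'n^'n" 1] by simp
qed

lemma measure_shear_cbox:
  fixes a b :: "real^'n::finite"
  assumes "m \<noteq> n"
  shows "measure lebesgue ((\<lambda>x. \<chi> i. if i = m then x $ m + x $ n else x $ i) ` cbox a b)
           = measure lebesgue (cbox a b)"
proof -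
  let ?h = "\<lambda>x::real^'n. \<chi> i. if i = m then x $ m + x $ n else x $ i"
  have lin: "linear ?h"
    by (rule linearI) (auto simp: vec_eq_iff algebra_simps)
  have box: "cbox a b = (+) a ` cbox 0 (b - a)"
    using cbox_translation[of a 0 "b - a"] by simp
  show ?thesis
  proof (cases "cbox 0 (b - a) = {}")
    case False
    have "?h ` cbox a b = (+) (?h a) ` ?h ` cbox 0 (b - a)"
      using box by (simp add: image_image linear_add[OF lin])
    then show ?thesis
      using measure_shear_interval[OF assms False] box by (simp add: measure_translation)
  qed (use box in simp)
qed

text \<open>The library proves this (measure_linear_image) only for index types of sort
  {finite, wellorder}; the induction over elementary linear maps needs only finiteness.\<close>

lemma
  fixes f :: "real^'n::finite \<Rightarrow> real^'n"
  assumes "linear f" and "S \<in> lmeasurable"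
  shows measurable_linear_image_cart: "f ` S \<in> lmeasurable"
    and measure_linear_image_cart:
      "measure lebesgue (f ` S) = \<bar>det (matrix f)\<bar> * measure lebesgue S"
proof -
  let ?scales = "\<lambda>f::real^'n \<Rightarrow> real^'n. \<forall>S \<in> lmeasurable.
    f ` S \<in> lmeasurable \<and> measure lebesgue (f ` S) = \<bar>det (matrix f)\<bar> * measure lebesgue S"
  have from_cbox: "?scales f" if "linear f"
    and "\<And>a b. measure lebesgue (f ` cbox a b) = \<bar>det (matrix f)\<bar> * measure lebesgue (cbox a b)"
    for f :: "real^'n \<Rightarrow> real^'n"
    using measure_linear_sufficient[OF that(1) _ that(2)] by simp
  have "?scales f"
  proof (rule induct_linear_elementary[OF \<open>linear f\<close>])
    fix f g :: "real^'n \<Rightarrow> real^'n"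
    assume "linear f" "linear g" and f: "?scales f" and g: "?scales g"
    show "?scales (f \<circ> g)"
    proof
      fix S :: "(real^'n) set"
      assume "S \<in> lmeasurable"
      then have "g ` S \<in> lmeasurable"
        using g by blast
      then show "(f \<circ> g) ` S \<in> lmeasurable \<and>
          measure lebesgue ((f \<circ> g) ` S) = \<bar>det (matrix (f \<circ> g))\<bar> * measure lebesgue S"
        using f g \<open>S \<in> lmeasurable\<close> \<open>linear f\<close> \<open>linear g\<close>
        unfolding image_comp[symmetric] by (simp add: matrix_compose det_mul abs_mult)
    qed
  next
    fix f :: "real^'n \<Rightarrow> real^'n" and i
    assume f: "linear f" "\<And>x. f x $ i = 0"
    then have "\<not> inj f"
      by (metis (full_types) linear_injective_imp_surjective one_neq_zero surjE vec_component)
    then have "det (matrix f) = 0"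
      using det_nz_iff_inj[OF f(1)] by blast
    moreover have "measure lebesgue (f ` cbox a b) = 0" for a b
      using \<open>\<not> inj f\<close> f(1) negligible_imp_measure0 negligible_linear_singular_image by blast
    ultimately show "?scales f"
      using from_cbox f(1) by simp
  next
    fix c :: "'n \<Rightarrow> real"
    show "?scales (\<lambda>x. \<chi> i. c i * x $ i)"
      by (simp add: measurable_stretch measure_stretch axis_def matrix_def det_diagonal)
  next
    fix m n :: 'n
    have "linear (\<lambda>x::real^'n. \<chi> i. x $ Transposition.transpose m n i)"
      by (rule linearI) (simp_all add: vec_eq_iff)
    then show "?scales (\<lambda>x. \<chi> i. x $ Transposition.transpose m n i)"
      by (intro from_cbox)
        (simp_all add: measure_swap_coordinates_cbox abs_det_matrix_involution fun_eq_iff vec_eq_iff)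
  next
    fix m n :: 'n
    assume "m \<noteq> n"
    have "linear (\<lambda>x::real^'n. \<chi> i. if i = m then x $ m + x $ n else x $ i)"
      by (rule linearI) (auto simp: vec_eq_iff algebra_simps)
    then show "?scales (\<lambda>x. \<chi> i. if i = m then x $ m + x $ n else x $ i)"
      using \<open>m \<noteq> n\<close>
      by (intro from_cbox) (simp_all add: measure_shear_cbox det_matrix_shear)
  qed
  then show "f ` S \<in> lmeasurable" "measure lebesgue (f ` S) = \<bar>det (matrix f)\<bar> * measure lebesgue S"
    using \<open>S \<in> lmeasurable\<close> by blast+
qed

lemma borel_measurable_matrix_vector_mult [measurable]:
  "(*v) (A :: real^'n::finite^'m::finite) \<in> borel_measurable borel"
  by (intro borel_measurable_continuous_onI linear_continuous_on matrix_vector_mul_bounded_linear)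

lemma lborel_eq_density_distr_linear:
  fixes A :: "real^'n::finite^'n"
  assumes "invertible A"
  shows "lborel = density (distr lborel borel ((*v) A)) (\<lambda>_. ennreal \<bar>det A\<bar>)"
proof (rule lborel_eqI)
  fix l u :: "real^'n"
  assume le: "\<And>b. b \<in> Basis \<Longrightarrow> l \<bullet> b \<le> u \<bullet> b"
  let ?B = "matrix_inv A"
  have preimage: "(*v) A -` box l u = (*v) ?B ` box l u"
    using assms by (force simp: matrix_vector_mul_matrix_inv matrix_inv_matrix_vector_mul)
  have "(*v) A -` box l u \<in> sets borel"
    using measurable_sets[OF borel_measurable_matrix_vector_mult[of A], of "box l u"] by simp
  then have "emeasure lborel ((*v) A -` box l u) = emeasure lebesgue ((*v) ?B ` box l u)"
    by (simp add: preimage)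
  also have "\<dots> = ennreal (\<bar>det ?B\<bar> * measure lebesgue (box l u))"
    using measurable_linear_image_cart[of "(*v) ?B" "box l u"]
      measure_linear_image_cart[of "(*v) ?B" "box l u"]
    by (simp add: emeasure_eq_measure2 matrix_vector_mul_linear del: measure_lborel_box_eq)
  finally have "emeasure lborel ((*v) A -` box l u)
      = ennreal (\<bar>det ?B\<bar> * measure lebesgue (box l u))" .
  then have "emeasure (density (distr lborel borel ((*v) A)) (\<lambda>_. ennreal \<bar>det A\<bar>)) (box l u)
      = ennreal (\<bar>det A\<bar> * \<bar>det ?B\<bar> * measure lebesgue (box l u))"
    by (simp add: emeasure_density_const emeasure_distr ennreal_mult mult.assoc)
  also have "\<bar>det A\<bar> * \<bar>det ?B\<bar> = 1"
    using det_mul_det_matrix_inv[OF assms] by (simp add: abs_mult[symmetric])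
  finally show "emeasure (density (distr lborel borel ((*v) A)) (\<lambda>_. ennreal \<bar>det A\<bar>)) (box l u)
      = (\<Prod>b\<in>Basis. (u - l) \<bullet> b)"
    using le by (simp add: emeasure_lborel_box_eq)
qed simp

lemma integral_linear_change:
  fixes A :: "real^'n::finite^'n" and h :: "real^'n \<Rightarrow> 'b::{banach, second_countable_topology}"
  assumes "invertible A" and h: "h \<in> borel_measurable borel"
  shows "integral\<^sup>L lborel h = \<bar>det A\<bar> *\<^sub>R integral\<^sup>L lborel (\<lambda>x. h (A *v x))"
proof -
  have "integral\<^sup>L lborel h
      = integral\<^sup>L (density (distr lborel borel ((*v) A)) (\<lambda>_. ennreal \<bar>det A\<bar>)) h"
    using lborel_eq_density_distr_linear[OF assms(1)] by simp
  also have "\<dots> = integral\<^sup>L (distr lborel borel ((*v) A)) (\<lambda>x. \<bar>det A\<bar> *\<^sub>R h x)"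
    using h by (intro integral_density) auto
  also have "\<dots> = integral\<^sup>L lborel (\<lambda>x. \<bar>det A\<bar> *\<^sub>R h (A *v x))"
    using h by (intro integral_distr) auto
  finally show ?thesis
    by simp
qed

lemma integral_matrix_inv_change:
  fixes A :: "real^'n::finite^'n" and h :: "real^'n \<Rightarrow> 'b::{banach, second_countable_topology}"
  assumes "invertible A" and "h \<in> borel_measurable borel"
  shows "integral\<^sup>L lborel (\<lambda>x. h (matrix_inv A *v x)) = \<bar>det A\<bar> *\<^sub>R integral\<^sup>L lborel h"
proof -
  have "\<bar>det A\<bar> * \<bar>det (matrix_inv A)\<bar> = 1"
    using det_mul_det_matrix_inv[OF assms(1)] by (simp add: abs_mult[symmetric])
  then show ?thesis
    using integral_linear_change[OF invertible_matrix_inv[OF assms(1)] assms(2)] by simp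
qed

lemma Zd_add: "x \<in> Zd \<Longrightarrow> y \<in> Zd \<Longrightarrow> x + y \<in> Zd"
  by (simp add: Zd_def)

lemma Zd_diff: "x \<in> Zd \<Longrightarrow> y \<in> Zd \<Longrightarrow> x - y \<in> Zd"
  by (simp add: Zd_def)

lemma zero_in_Zd: "0 \<in> Zd"
  by (simp add: Zd_def)

lemma inner_Zd_in_Ints: "x \<in> Zd \<Longrightarrow> y \<in> Zd \<Longrightarrow> x \<bullet> y \<in> \<int>"
  unfolding inner_vec_def Zd_def by (auto intro!: Ints_sum Ints_mult)

lemma inner_matrix_vector_mult_left: "(A *v x) \<bullet> y = (x::real^'n::finite) \<bullet> (transpose A *v y)"
  by (metis dot_lmul_matrix inner_commute transpose_matrix_vector)

lemma reps_in_Zd: "reps A p th \<Longrightarrow> r < p \<Longrightarrow> A *v th r \<in> Zd"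
  by (simp add: reps_def)

lemma reps_eqI: "reps A p th \<Longrightarrow> r < p \<Longrightarrow> s < p \<Longrightarrow> th r - th s \<in> Zd \<Longrightarrow> r = s"
  by (simp add: reps_def)

lemma reps_cover: "reps A p th \<Longrightarrow> A *v x \<in> Zd \<Longrightarrow> \<exists>r<p. x - th r \<in> Zd"
  by (simp add: reps_def)

lemma the_reps_index:
  fixes A :: "real^'n::finite^'n"
  assumes "reps A p th" "invertible A" "l < p" "m \<in> Zd" "k = A *v th l + A *v m"
  shows "(THE l. l < p \<and> (\<exists>m\<in>Zd. k = A *v th l + A *v m)) = l"
proof (rule the_equality)
  fix l' assume "l' < p \<and> (\<exists>m\<in>Zd. k = A *v th l' + A *v m)"
  then obtain m' where l': "l' < p" "m' \<in> Zd" "A *v (th l' + m') = A *v (th l + m)"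
    using assms(5) by (auto simp: matrix_vector_right_distrib)
  then have "th l' + m' = th l + m"
    by (metis assms(2) matrix_inv_matrix_vector_mul)
  then have "th l' - th l = m - m'"
    by (simp add: algebra_simps)
  then show "l' = l"
    using reps_eqI[OF assms(1) l'(1) assms(3)] Zd_diff[OF assms(4) l'(2)] by simp
qed (use assms in blast)

lemma exp_2pi_i_eq_cis: "exp (2 * of_real pi * \<i> * of_real t) = cis (2 * pi * t)"
  by (simp add: cis_conv_exp mult_ac)

lemma cis_2pi_eq_1_iff: "cis (2 * pi * t) = 1 \<longleftrightarrow> t \<in> \<int>"
proof
  assume "cis (2 * pi * t) = 1"
  then obtain n :: int where "2 * pi * t = of_int (2 * n) * pi"
    unfolding cis_conv_exp exp_eq_1 by auto
  then show "t \<in> \<int>"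
    by simp
qed (metis cis_multiple_2pi)

lemma cis_2pi_eqI:
  assumes "s - t \<in> \<int>"
  shows "cis (2 * pi * s) = cis (2 * pi * t)"
proof -
  have "cis (2 * pi * s) = cis (2 * pi * (s - t)) * cis (2 * pi * t)"
    by (simp add: cis_mult algebra_simps)
  then show ?thesis
    using assms by simp
qed

lemma reps_translation:
  assumes reps: "reps A p th" and a: "a < p"
  obtains \<tau> where "bij_betw \<tau> {..<p} {..<p}" "\<And>q. q < p \<Longrightarrow> th q + th a - th (\<tau> q) \<in> Zd"
proof -
  have "\<exists>q'<p. th q + th a - th q' \<in> Zd" if "q < p" for q
    using reps_cover[OF reps, of "th q + th a"] reps_in_Zd[OF reps] that a
    by (simp add: matrix_vector_right_distrib Zd_add)
  then obtain \<tau> where \<tau>: "\<And>q. q < p \<Longrightarrow> \<tau> q < p \<and> th q + th a - th (\<tau> q) \<in> Zd"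
    by metis
  have "inj_on \<tau> {..<p}"
  proof
    fix q q' assume "q \<in> {..<p}" "q' \<in> {..<p}" "\<tau> q = \<tau> q'"
    then have "(th q + th a - th (\<tau> q)) - (th q' + th a - th (\<tau> q')) \<in> Zd"
      using \<tau> Zd_diff by blast
    with \<open>\<tau> q = \<tau> q'\<close> show "q = q'"
      using reps_eqI[OF reps] \<open>q \<in> {..<p}\<close> \<open>q' \<in> {..<p}\<close> by simp
  qed
  moreover have "\<tau> ` {..<p} = {..<p}"
    using \<tau> \<open>inj_on \<tau> {..<p}\<close> by (intro endo_inj_surj) auto
  ultimately show thesis
    using \<tau> that by (simp add: bij_betw_def)
qed

lemma sum_cis_reps:
  fixes B :: "real^'n::finite^'n"
  assumes reps: "reps B p th" and inv: "invertible B" and x: "transpose B *v x \<in> Zd"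
  shows "(\<Sum>q<p. cis (2 * pi * (x \<bullet> (B *v th q)))) = (if x \<in> Zd then of_nat p else 0)"
proof (cases "x \<in> Zd")
  case True
  then show ?thesis
    using reps_in_Zd[OF reps] by (simp add: inner_Zd_in_Ints)
next
  case False
  txt \<open>Some representative th q0 has a character value c \<noteq> 1; translation by th q0
    permutes the representatives modulo Z^d, so multiplying the sum by c does not change it.\<close>
  let ?\<chi> = "\<lambda>q. cis (2 * pi * (x \<bullet> (B *v th q)))"
  have pairing_Ints: "x \<bullet> (B *v z) \<in> \<int>" if "z \<in> Zd" for z
    using x that by (metis dot_lmul_matrix inner_Zd_in_Ints transpose_matrix_vector)
  from False obtain i where "x $ i \<notin> \<int>"
    by (auto simp: Zd_def)
  define y where "y = matrix_inv B *v axis i 1"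
  have By: "B *v y = axis i 1"
    by (simp add: y_def matrix_vector_mul_matrix_inv[OF inv])
  moreover have "axis i 1 \<in> Zd"
    by (simp add: Zd_def axis_def)
  ultimately obtain q0 where q0: "q0 < p" "y - th q0 \<in> Zd"
    using reps_cover[OF reps, of y] by auto
  have "x $ i = x \<bullet> (B *v (y - th q0)) + x \<bullet> (B *v th q0)"
    by (simp add: matrix_vector_mult_diff_distrib inner_diff_right By inner_axis)
  then have "x \<bullet> (B *v th q0) \<notin> \<int>"
    using \<open>x $ i \<notin> \<int>\<close> pairing_Ints[OF q0(2)] by (metis Ints_add)
  then have c: "?\<chi> q0 \<noteq> 1"
    by (simp add: cis_2pi_eq_1_iff)
  obtain \<tau> where \<tau>: "bij_betw \<tau> {..<p} {..<p}" "\<And>q. q < p \<Longrightarrow> th q + th q0 - th (\<tau> q) \<in> Zd"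
    using reps_translation[OF reps q0(1)] by blast
  have shift: "?\<chi> (\<tau> q) = ?\<chi> q * ?\<chi> q0" if "q < p" for q
  proof -
    have "x \<bullet> (B *v th q) + x \<bullet> (B *v th q0) - x \<bullet> (B *v th (\<tau> q)) \<in> \<int>"
      using pairing_Ints[OF \<tau>(2)[OF that]]
      by (simp add: matrix_vector_mult_diff_distrib matrix_vector_right_distrib inner_add_right
          inner_diff_right)
    then show ?thesis
      by (simp add: cis_mult distrib_left[symmetric] cis_2pi_eqI)
  qed
  have "(\<Sum>q<p. ?\<chi> q) = (\<Sum>q<p. ?\<chi> (\<tau> q))"
    using sum.reindex_bij_betw[OF \<tau>(1), of ?\<chi>] by simp
  also have "\<dots> = (\<Sum>q<p. ?\<chi> q) * ?\<chi> q0"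
    by (simp add: shift sum_distrib_right)
  finally have "(\<Sum>q<p. ?\<chi> q) * (1 - ?\<chi> q0) = 0"
    by (simp add: algebra_simps)
  then show ?thesis
    using False c by simp
qed

lemma funpow_inv_cancel:
  fixes s :: "'a \<Rightarrow> 'a"
  assumes "bij s"
  shows "(s ^^ n) ((inv s ^^ n) x) = x"
proof (induction n arbitrary: x)
  case (Suc n)
  have "(s ^^ Suc n) ((inv s ^^ Suc n) x) = s ((s ^^ n) ((inv s ^^ n) (inv s x)))"
    by (metis funpow_swap1 funpow.simps(2) o_apply)
  also have "\<dots> = x"
    using Suc assms by (simp add: bij_is_surj surj_f_inv_f)
  finally show ?case .
qed simp

lemma perm_ipow_permutes:
  assumes "s permutes S"
  shows "perm_ipow s j permutes S"
proof -
  have "(f ^^ n) permutes S" if "f permutes S" for f n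
    using that by (induction n) (simp_all add: permutes_id permutes_compose)
  then show ?thesis
    using assms by (simp add: perm_ipow_def permutes_inv)
qed

lemma perm_ipow_perm_ipow_uminus:
  assumes "s permutes S"
  shows "perm_ipow s j (perm_ipow s (- j) x) = x"
proof -
  have "bij s" "bij (inv s)"
    using assms permutes_inv by (blast intro: permutes_bij)+
  then show ?thesis
    using funpow_inv_cancel[of s] funpow_inv_cancel[of "inv s"]
    by (simp add: perm_ipow_def inv_inv_eq)
qed

lemma perm_ipow_adjoint:
  fixes pair :: "nat \<Rightarrow> nat \<Rightarrow> real"
  assumes s: "s permutes S" and t: "t permutes T"
    and adjoint: "\<And>a b. a \<in> S \<Longrightarrow> b \<in> T \<Longrightarrow> pair (s a) b - pair a (t b) \<in> \<int>"
    and "a \<in> S" "b \<in> T"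
  shows "pair (perm_ipow s j a) b - pair a (perm_ipow t j b) \<in> \<int>"
proof -
  have funpow: "pair ((s ^^ n) a) b - pair a ((t ^^ n) b) \<in> \<int>" if "a \<in> S" "b \<in> T" for n a b
    using that
  proof (induction n arbitrary: b)
    case (Suc n)
    have "pair (s ((s ^^ n) a)) b - pair ((s ^^ n) a) (t b) \<in> \<int>"
      using Suc.prems s by (intro adjoint permutes_in_funpow_image)
    moreover have "pair ((s ^^ n) a) (t b) - pair a ((t ^^ n) (t b)) \<in> \<int>"
      using Suc t by (simp add: permutes_in_image)
    ultimately have "pair (s ((s ^^ n) a)) b - pair a ((t ^^ n) (t b)) \<in> \<int>"
      using Ints_add by fastforce
    then show ?case
      by (simp add: funpow_swap1)
  qed simp
  show ?thesis
  proof (cases "0 \<le> j")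
    case True
    then show ?thesis
      using funpow[OF assms(4,5)] by (simp add: perm_ipow_def)
  next
    case False
    let ?a = "(inv s ^^ nat (- j)) a" and ?b = "(inv t ^^ nat (- j)) b"
    have "pair ((s ^^ nat (- j)) ?a) ?b - pair ?a ((t ^^ nat (- j)) ?b) \<in> \<int>"
      using assms(4,5) s t by (intro funpow) (simp_all add: permutes_in_funpow_image permutes_inv)
    then have "pair a ?b - pair ?a b \<in> \<int>"
      using s t by (simp add: funpow_inv_cancel permutes_bij)
    then have "pair ?a b - pair a ?b \<in> \<int>"
      by (metis Ints_minus minus_diff_eq)
    then show ?thesis
      using False by (simp add: perm_ipow_def)
  qed
qed

lemma dil_funpow_conjugate:
  fixes P A :: "real^'n::finite^'n"
  assumes "invertible P"
  shows "(dil (P ** A ** matrix_inv P) ^^ n) h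
    = (\<lambda>x. (dil A ^^ n) (\<lambda>y. h (P *v y)) (matrix_inv P *v x))"
proof (induction n)
  case 0
  then show ?case
    by (simp add: matrix_vector_mul_matrix_inv[OF assms])
next
  case (Suc n)
  then show ?case
    by (simp add: dil_def det_conjugate[OF assms] matrix_vector_mul_assoc[symmetric]
        matrix_inv_matrix_vector_mul[OF assms])
qed

lemma dil_pow_conjugate:
  fixes P A :: "real^'n::finite^'n"
  assumes "invertible P" "invertible A"
  shows "dil_pow (P ** A ** matrix_inv P) j h
    = (\<lambda>x. dil_pow A j (\<lambda>y. h (P *v y)) (matrix_inv P *v x))"
  by (simp add: dil_pow_def matrix_inv_conjugate[OF assms] dil_funpow_conjugate[OF assms(1)])

lemma dil_pow_scale: "dil_pow A j (\<lambda>x. c * h x) = (\<lambda>x. c * dil_pow A j h x)"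
proof -
  have "(dil B ^^ n) (\<lambda>x. c * h x) = (\<lambda>x. c * (dil B ^^ n) h x)" for B n
    by (induction n) (simp_all add: dil_def mult.left_commute)
  then show ?thesis
    by (simp add: dil_pow_def)
qed

lemma borel_measurable_dil_pow:
  fixes h :: "real^'n::finite \<Rightarrow> complex"
  assumes "h \<in> borel_measurable borel"
  shows "dil_pow A j h \<in> borel_measurable borel"
proof -
  have "(dil B ^^ n) h \<in> borel_measurable borel" for B n
    by (induction n) (simp_all add: assms dil_def)
  then show ?thesis
    by (simp add: dil_pow_def)
qed

lemma DH_pow_apply: "DH_pow A s j F q = dil_pow A j (F (perm_ipow s (- j) q))"
proof -
  have "(DH A s ^^ n) F = (\<lambda>q. (dil A ^^ n) (F ((inv s ^^ n) q)))" for n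
    by (induction n arbitrary: F)
      (simp_all add: DH_def funpow_Suc_right funpow_swap1 del: funpow.simps(2))
  moreover have "(DH_inv A s ^^ n) F = (\<lambda>q. (dil (matrix_inv A) ^^ n) (F ((s ^^ n) q)))" for n
    by (induction n arbitrary: F)
      (simp_all add: DH_inv_def funpow_Suc_right funpow_swap1 del: funpow.simps(2))
  ultimately show ?thesis
    by (simp add: DH_pow_def dil_pow_def perm_ipow_def)
qed

lemma TH_S'_apply:
  "q < p \<Longrightarrow> TH ths u (S' p A g) q x
    = cis (2 * pi * (u \<bullet> ths q)) / of_nat p * g (matrix_inv A *v x - matrix_inv A *v u)"
  by (simp add: TH_def S'_def transl_def exp_2pi_i_eq_cis matrix_vector_mult_diff_distrib)

locale oversampling =
  fixes P M :: "real^'d::finite^'d" and p :: nat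
    and th ths :: "nat \<Rightarrow> real^'d" and sigma sigmas :: "nat \<Rightarrow> nat"
  assumes invertible_P: "invertible P" and invertible_M: "invertible M"
    and p_det: "real p = \<bar>det P\<bar>"
    and th: "reps P p th" and ths: "reps (transpose P) p ths"
    and sigma: "sigma permutes {..<p}"
    and sigma_th: "\<And>r. r < p \<Longrightarrow> M *v th r - th (sigma r) \<in> Zd"
    and sigmas: "sigmas permutes {..<p}"
    and sigmas_ths: "\<And>q. q < p \<Longrightarrow>
      transpose (P ** M ** matrix_inv P) *v ths q - ths (sigmas q) \<in> Zd"
begin

lemma p_nonzero: "p \<noteq> 0"
  using p_det invertible_P by (simp add: invertible_det_nz)

lemma pairing_sigma:
  assumes a: "a < p" and b: "b < p"
  shows "(P *v th (sigma a)) \<bullet> ths b - (P *v th a) \<bullet> ths (sigmas b) \<in> \<int>"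
proof -
  define M' where "M' = P ** M ** matrix_inv P"
  define u z w where "u = P *v th a" and "z = M *v th a - th (sigma a)"
    and "w = transpose M' *v ths b - ths (sigmas b)"
  have Zd: "u \<in> Zd" "z \<in> Zd" "w \<in> Zd" "transpose P *v ths b \<in> Zd"
    using reps_in_Zd[OF th a] sigma_th[OF a] sigmas_ths[OF b] reps_in_Zd[OF ths b]
    by (simp_all add: u_def z_def w_def M'_def)
  have "P *v th (sigma a) = M' *v u - P *v z"
    by (simp add: u_def z_def M'_def matrix_vector_mult_diff_distrib
        matrix_vector_mul_assoc[symmetric] matrix_inv_matrix_vector_mul[OF invertible_P])
  then have "(P *v th (sigma a)) \<bullet> ths b - (P *v th a) \<bullet> ths (sigmas b)
      = u \<bullet> w - z \<bullet> (transpose P *v ths b)"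
    by (simp only: inner_diff_left inner_matrix_vector_mult_left w_def u_def inner_diff_right)
  then show ?thesis
    using Zd by (simp add: inner_Zd_in_Ints)
qed

lemma pairing_perm_ipow:
  assumes "r < p" "q < p"
  shows "(P *v th r) \<bullet> ths q
    - (P *v th (perm_ipow sigma j r)) \<bullet> ths (perm_ipow sigmas (- j) q) \<in> \<int>"
proof -
  have "perm_ipow sigmas (- j) q < p"
    using permutes_in_image[OF perm_ipow_permutes[OF sigmas]] assms(2) by simp
  then have "(P *v th (perm_ipow sigma j r)) \<bullet> ths (perm_ipow sigmas (- j) q)
      - (P *v th r) \<bullet> ths (perm_ipow sigmas j (perm_ipow sigmas (- j) q)) \<in> \<int>"
    using assms(1) pairing_sigma
    by (intro perm_ipow_adjoint[OF sigma sigmas, where pair = "\<lambda>a b. (P *v th a) \<bullet> ths b"])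
      simp_all
  then show ?thesis
    using Ints_minus by (fastforce simp: perm_ipow_perm_ipow_uminus[OF sigmas])
qed

lemma sum_cis_phases:
  assumes l: "l < p" and m: "m \<in> Zd" and k: "k = P *v th l + P *v m" and r: "r < p"
  shows "(\<Sum>q<p. cis (2 * pi * (k \<bullet> ths (perm_ipow sigmas (- j) q) - (P *v th r) \<bullet> ths q)))
    = (if l = perm_ipow sigma j r then of_nat p else 0)"
proof -
  let ?\<pi> = "perm_ipow sigmas (- j)" and ?\<rho> = "perm_ipow sigma j r"
  let ?x = "th l - th ?\<rho>"
  have \<rho>: "?\<rho> < p"
    using permutes_in_image[OF perm_ipow_permutes[OF sigma]] r by simp
  have phase: "cis (2 * pi * (k \<bullet> ths (?\<pi> q) - (P *v th r) \<bullet> ths q))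
      = cis (2 * pi * (?x \<bullet> (transpose P *v ths (?\<pi> q))))" if "q < p" for q
  proof (rule cis_2pi_eqI)
    have "?\<pi> q < p"
      using permutes_in_image[OF perm_ipow_permutes[OF sigmas]] that by simp
    then have "(P *v m) \<bullet> ths (?\<pi> q) \<in> \<int>"
      using m reps_in_Zd[OF ths] by (simp add: inner_matrix_vector_mult_left inner_Zd_in_Ints)
    then have "(P *v m) \<bullet> ths (?\<pi> q)
        - ((P *v th r) \<bullet> ths q - (P *v th ?\<rho>) \<bullet> ths (?\<pi> q)) \<in> \<int>"
      using pairing_perm_ipow[OF r that] by (rule Ints_diff)
    moreover have "?x \<bullet> (transpose P *v ths (?\<pi> q))
        = (P *v th l) \<bullet> ths (?\<pi> q) - (P *v th ?\<rho>) \<bullet> ths (?\<pi> q)"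
      by (simp only: inner_matrix_vector_mult_left[symmetric] matrix_vector_mult_diff_distrib
          inner_diff_left)
    ultimately show "(k \<bullet> ths (?\<pi> q) - (P *v th r) \<bullet> ths q)
        - ?x \<bullet> (transpose P *v ths (?\<pi> q)) \<in> \<int>"
      unfolding k inner_add_left by (simp only:) (simp add: algebra_simps)
  qed
  have "(\<Sum>q<p. cis (2 * pi * (k \<bullet> ths (?\<pi> q) - (P *v th r) \<bullet> ths q)))
      = (\<Sum>q<p. cis (2 * pi * (?x \<bullet> (transpose P *v ths (?\<pi> q)))))"
    by (rule sum.cong) (simp_all add: phase del: transpose_matrix_vector)
  also have "\<dots> = (\<Sum>q<p. cis (2 * pi * (?x \<bullet> (transpose P *v ths q))))"
    using sum.permute[OF perm_ipow_permutes[OF sigmas],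
        of "\<lambda>q. cis (2 * pi * (?x \<bullet> (transpose P *v ths q)))" "- j"]
    by (simp add: o_def del: transpose_matrix_vector)
  also have "\<dots> = (if ?x \<in> Zd then of_nat p else 0)"
    using reps_in_Zd[OF th l] reps_in_Zd[OF th \<rho>] invertible_P
    by (intro sum_cis_reps[OF ths])
      (simp_all add: matrix_vector_mult_diff_distrib Zd_diff invertible_det_nz det_transpose)
  also have "(?x \<in> Zd) = (l = ?\<rho>)"
    using reps_eqI[OF th l \<rho>] zero_in_Zd by auto
  finally show ?thesis .
qed

lemma DH_pow_TH_S'_apply:
  assumes "q < p"
  shows "DH_pow (P ** M ** matrix_inv P) sigmas j (TH ths k (S' p P f)) q
    = (\<lambda>x. cis (2 * pi * (k \<bullet> ths (perm_ipow sigmas (- j) q))) / of_nat p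
        * dil_pow M j (transl (matrix_inv P *v k) f) (matrix_inv P *v x))"
proof -
  define c where "c = cis (2 * pi * (k \<bullet> ths (perm_ipow sigmas (- j) q))) / of_nat p"
  have "perm_ipow sigmas (- j) q < p"
    using permutes_in_image[OF perm_ipow_permutes[OF sigmas]] assms by simp
  then have "(\<lambda>y. TH ths k (S' p P f) (perm_ipow sigmas (- j) q) (P *v y))
      = (\<lambda>y. c * transl (matrix_inv P *v k) f y)"
    by (simp add: TH_S'_apply transl_def matrix_inv_matrix_vector_mul[OF invertible_P] c_def)
  then have "DH_pow (P ** M ** matrix_inv P) sigmas j (TH ths k (S' p P f)) q
      = (\<lambda>x. c * dil_pow M j (transl (matrix_inv P *v k) f) (matrix_inv P *v x))"
    unfolding DH_pow_apply dil_pow_conjugate[OF invertible_P invertible_M]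
    by (simp add: dil_pow_scale)
  then show ?thesis
    by (simp add: c_def)
qed

lemma ip_DH_pow_TH_component:
  assumes r: "r < p" and q: "q < p"
    and f: "f \<in> borel_measurable borel" and g: "g \<in> borel_measurable borel"
  shows "ip (DH_pow (P ** M ** matrix_inv P) sigmas j (TH ths k (S' p P f)) q)
            (TH ths (P *v th r) (S' p P g) q)
    = cis (2 * pi * (k \<bullet> ths (perm_ipow sigmas (- j) q) - (P *v th r) \<bullet> ths q)) / of_nat p
      * ip (dil_pow M j (transl (matrix_inv P *v k) f)) (transl (th r) g)"
proof -
  let ?Pi = "matrix_inv P"
  define U where "U = dil_pow M j (transl (?Pi *v k) f)"
  define V where "V = transl (th r) g"
  define a where "a = cis (2 * pi * (k \<bullet> ths (perm_ipow sigmas (- j) q))) / of_nat p"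
  define b where "b = cis (2 * pi * ((P *v th r) \<bullet> ths q)) / of_nat p"
  define W where "W = (\<lambda>x. U x * cnj (V x))"
  have "transl (?Pi *v k) f \<in> borel_measurable borel" "V \<in> borel_measurable borel"
    using f g unfolding V_def transl_def by measurable
  then have "U \<in> borel_measurable borel" "V \<in> borel_measurable borel"
    by (simp_all add: U_def borel_measurable_dil_pow)
  moreover have [measurable]: "cnj \<in> borel_measurable (borel :: complex measure)"
    by (intro borel_measurable_continuous_onI continuous_intros)
  ultimately have W: "W \<in> borel_measurable borel"
    unfolding W_def by measurable
  txt \<open>Both components are functions of P^{-1} x, so the substitution x = P y contributes
    |det P| = p.\<close>
  have "(\<lambda>x. DH_pow (P ** M ** ?Pi) sigmas j (TH ths k (S' p P f)) q x
        * cnj (TH ths (P *v th r) (S' p P g) q x))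
      = (\<lambda>x. a * cnj b * W (?Pi *v x))"
    using q by (simp add: DH_pow_TH_S'_apply TH_S'_apply a_def b_def U_def V_def W_def
        transl_def matrix_inv_matrix_vector_mul[OF invertible_P] mult_ac)
  then have "ip (DH_pow (P ** M ** ?Pi) sigmas j (TH ths k (S' p P f)) q)
        (TH ths (P *v th r) (S' p P g) q)
      = a * cnj b * integral\<^sup>L lborel (\<lambda>x. W (?Pi *v x))"
    by (simp add: ip_def)
  also have "\<dots> = a * cnj b * of_nat p * ip U V"
    using integral_matrix_inv_change[OF invertible_P W]
    by (simp add: ip_def W_def scaleR_conv_of_real flip: p_det)
  also have "a * cnj b * of_nat p
      = cis (2 * pi * (k \<bullet> ths (perm_ipow sigmas (- j) q) - (P *v th r) \<bullet> ths q)) / of_nat p"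
    using p_nonzero by (simp add: a_def b_def cis_cnj cis_mult algebra_simps power2_eq_square)
  finally show ?thesis
    by (simp add: U_def V_def)
qed

theorem ipH_DH_pow_TH_S':
  assumes k: "k \<in> Zd" and r: "r < p"
    and f: "f \<in> borel_measurable borel" and g: "g \<in> borel_measurable borel"
  shows "ipH p (DH_pow (P ** M ** matrix_inv P) sigmas j (TH ths k (S' p P f)))
               (TH ths (P *v th r) (S' p P g))
    = (if (THE l. l < p \<and> (\<exists>m\<in>Zd. k = P *v th l + P *v m)) = perm_ipow sigma j r then 1 else 0)
      * ip (dil_pow M j (transl (matrix_inv P *v k) f)) (transl (th r) g)"
proof -
  have "P *v (matrix_inv P *v k) \<in> Zd"
    using k by (simp add: matrix_vector_mul_matrix_inv[OF invertible_P])
  then obtain l where l: "l < p" "matrix_inv P *v k - th l \<in> Zd"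
    using reps_cover[OF th] by blast
  define m where "m = matrix_inv P *v k - th l"
  have k_eq: "k = P *v th l + P *v m"
    by (simp add: m_def matrix_vector_mult_diff_distrib matrix_vector_mul_matrix_inv[OF invertible_P])
  show ?thesis
    using p_nonzero the_reps_index[OF th invertible_P l(1) l(2)[folded m_def] k_eq]
      sum_cis_phases[OF l(1) l(2)[folded m_def] k_eq r, of j]
    by (simp add: ipH_def ip_DH_pow_TH_component[OF r _ f g] sum_divide_distrib[symmetric]
        sum_distrib_right[symmetric])
qed

end

lemma invertible_rmat_if_expansive:
  assumes "expansive M"
  shows "invertible (rmat M)"
proof (rule ccontr)
  assume "\<not> invertible (rmat M)"
  then obtain x where x: "rmat M *v x = 0" "x \<noteq> 0"
    using invertible_left_inverse matrix_left_invertible_ker by blast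
  define v :: "complex^'a" where "v = (\<chi> i. complex_of_real (x $ i))"
  have "v \<noteq> 0"
    using x(2) by (auto simp: v_def vec_eq_iff)
  moreover have "((\<chi> i j. of_int (M $ i $ j)) *v v) $ i = complex_of_real ((rmat M *v x) $ i)" for i
    by (simp add: matrix_vector_mult_def v_def rmat_def)
  then have "(\<chi> i j. of_int (M $ i $ j)) *v v = (0::complex) *s v"
    using x(1) by (simp add: vec_eq_iff)
  ultimately show False
    using assms unfolding expansive_def by force
qed

lemma det_rmat: "det (rmat A) = real_of_int (det A)"
  unfolding det_def rmat_def by simp

theorem lemma4p3:
  fixes M P :: "int^'d^'d" and p :: nat
    and th ths :: "nat \<Rightarrow> real^'d" and sigma sigmas :: "nat \<Rightarrow> nat"
    and f g :: "real^'d \<Rightarrow> complex" and k :: "real^'d" and j :: int and r :: nat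
  assumes expM: "expansive M"
    and p_def: "p = nat \<bar>det P\<bar>" and p_nz: "p \<noteq> 0"
    and adm: "admissible P M"
    and th: "reps (rmat P) p th"
    and ths: "reps (transpose (rmat P)) p ths"
    and sigma: "sigma permutes {..<p}"
    and sigma_prop: "\<forall>r<p. rmat M *v th r - th (sigma r) \<in> Zd"
    and sigmas: "sigmas permutes {..<p}"
    and sigmas_prop: "\<forall>q<p. transpose (rmat P ** rmat M ** matrix_inv (rmat P)) *v ths q
                               - ths (sigmas q) \<in> Zd"
    and f: "L2 f" and g: "L2 g"
    and k: "k \<in> Zd" and r: "r < p"
  shows "ipH p (DH_pow (rmat P ** rmat M ** matrix_inv (rmat P)) sigmas j
                   (TH ths k (S' p (rmat P) f)))
               (TH ths (rmat P *v th r) (S' p (rmat P) g))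
         = (if (THE l. l < p \<and> (\<exists>m\<in>Zd. k = rmat P *v th l + rmat P *v m)) = perm_ipow sigma j r
            then 1 else 0)
           * ip (dil_pow (rmat M) j (transl (matrix_inv (rmat P) *v k) f)) (transl (th r) g)"
proof -
  have "real p = \<bar>det (rmat P)\<bar>"
    using p_def by (simp add: det_rmat)
  moreover have "invertible (rmat P)"
    using p_def p_nz by (simp add: invertible_det_nz det_rmat)
  ultimately interpret oversampling "rmat P" "rmat M" p th ths sigma sigmas
    using invertible_rmat_if_expansive[OF expM] th ths sigma sigma_prop sigmas sigmas_prop
    by unfold_locales simp_all
  show ?thesis
    using f g unfolding L2_def by (intro ipH_DH_pow_TH_S' k r) simp_all
qed

end
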